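(* Let $(X,\|\cdot\|)$ be a real Banach space, $\varepsilon>0$, and let $f:X\to\overline{\mathbb R}$ be a proper $\varepsilon$-uniformly convex function such that $\breve f$ is proper. Then $f$ is bounded below and coercive; more precisely, $$\liminf_{\|x\|\to+\infty}\frac{f(x)}{\|x\|^2}>0.$$ Moreover, for any $\varepsilon'>\varepsilon$ there exist $\delta,\eta>0$ such that: if $x_0^*\in X^*$ and $x_0\in X$ satisfy $$f(x_0)+x_0^*(x_0)<\inf_X(f+x_0^* )+\delta,$$ and if $x^*\in X^*$ satisfies $\|x^*-x_0^*\|<\eta$ and $x\in X$ minimizes $f+x^*$, then $\|x-x_0\|\le\varepsilon'$. The existence of such a pair $(x,x^* )$ (that is, $x^*\in X^*$ with $\|x^*-x_0^*\|<\eta$ and $x\in X$ minimizing $f+x^*$) is guaranteed if $f=\breve f$.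
   Context: $\overline{\mathbb R}=\mathbb R\cup\{-\infty,+\infty\}$. A function $f:X\to\overline{\mathbb R}$ is proper if $f(x)>-\infty$ for all $x$ and $\operatorname{dom}(f)=\{x: f(x)<+\infty\}\neq\emptyset$. A function $f$ is $\varepsilon$-uniformly convex if there is $\delta>0$ such that $f\left(\frac{x+y}{2}\right)\le\frac{f(x)+f(y)}{2}-\delta$ whenever $\|x-y\|\ge\varepsilon$ (no convexity of $f$ is assumed; the inequality is vacuous if $x$ or $y$ is not in $\operatorname{dom}(f)$). $\breve f$ denotes the lower semicontinuous convex envelope of $f$, i.e. the function whose epigraph is the closed convex hull of the epigraph of $f$. Coercive means $f(x)\to+\infty$ as $\|x\|\to+\infty$. *)

theory Defs
  imports "HOL-Analysis.Analysis"
begin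

definition proper_fun :: "('a \<Rightarrow> ereal) \<Rightarrow> bool" where
  "proper_fun f \<longleftrightarrow> (\<forall>x. f x > -\<infinity>) \<and> {x. f x < \<infinity>} \<noteq> {}"

text \<open>
  No convexity of the function is assumed. In \<^typ>\<open>ereal\<close> the sum of two values one of which
  is \<open>\<infinity>\<close> is \<open>\<infinity>\<close>, so the inequality is vacuous when \<open>f x\<close> or \<open>f y\<close> is \<open>\<infinity>\<close>.
\<close>
definition eps_uniformly_convex :: "real \<Rightarrow> ('a::real_normed_vector \<Rightarrow> ereal) \<Rightarrow> bool" where
  "eps_uniformly_convex \<epsilon> f \<longleftrightarrow>
     (\<exists>\<delta>::real. \<delta> > 0 \<and>
        (\<forall>x y. norm (x - y) \<ge> \<epsilon> \<longrightarrow>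
           f ((1/2) *\<^sub>R (x + y)) \<le> (f x + f y) / 2 - ereal \<delta>))"

text \<open>The library's \<open>epigraph\<close> is for real-valued functions only.\<close>
definition ereal_epigraph :: "('a \<Rightarrow> ereal) \<Rightarrow> ('a \<times> real) set" where
  "ereal_epigraph f = {(x, t). f x \<le> ereal t}"

text \<open>
  The infimum (\<open>\<infinity>\<close> if the fibre over \<open>x\<close> is empty) reads off the function from its epigraph;
  that the epigraph really is the closed convex hull is
  \<open>ereal_epigraph_lsc_convex_envelope\<close> below, and it determines the function.
\<close>
definition lsc_convex_envelope :: "('a::real_normed_vector \<Rightarrow> ereal) \<Rightarrow> 'a \<Rightarrow> ereal" where
  "lsc_convex_envelope f x =
     Inf (ereal ` {t. (x, t) \<in> closure (convex hull (ereal_epigraph f))})"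

lemma closed_convex_hull_epigraph_upward:
  fixes f :: "'a::real_normed_vector \<Rightarrow> ereal"
  assumes "(x, t) \<in> closure (convex hull (ereal_epigraph f))" and "t \<le> s"
  shows "(x, s) \<in> closure (convex hull (ereal_epigraph f))"
proof -
  let ?v = "(0::'a, s - t)"
  have "(+) ?v ` ereal_epigraph f \<subseteq> ereal_epigraph f"
  proof clarsimp
    fix a b assume "(a, b) \<in> ereal_epigraph f"
    then have "f a \<le> ereal b" by (simp add: ereal_epigraph_def)
    also have "\<dots> \<le> ereal (s - t + b)" using assms(2) by simp
    finally show "(a, s - t + b) \<in> ereal_epigraph f" by (simp add: ereal_epigraph_def)
  qed
  then have "closure (convex hull ((+) ?v ` ereal_epigraph f))
      \<subseteq> closure (convex hull (ereal_epigraph f))"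
    by (intro closure_mono hull_mono)
  then have "(+) ?v ` closure (convex hull (ereal_epigraph f))
      \<subseteq> closure (convex hull (ereal_epigraph f))"
    by (simp add: convex_hull_translation closure_translation)
  moreover have "(x, s) = ?v + (x, t)" by simp
  ultimately show ?thesis using assms(1) by blast
qed

lemma ereal_epigraph_lsc_convex_envelope:
  fixes f :: "'a::real_normed_vector \<Rightarrow> ereal"
  shows "ereal_epigraph (lsc_convex_envelope f) = closure (convex hull (ereal_epigraph f))"
    (is "?L = ?C")
proof (intro equalityI subsetI)
  fix p assume "p \<in> ?C"
  then show "p \<in> ?L"
    by (cases p) (auto simp: ereal_epigraph_def lsc_convex_envelope_def intro: INF_lower)
next
  fix p assume "p \<in> ?L"
  obtain x s where p: "p = (x, s)" by (cases p)
  have le: "Inf (ereal ` {t. (x, t) \<in> ?C}) \<le> ereal s"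
    using \<open>p \<in> ?L\<close> by (simp add: p ereal_epigraph_def lsc_convex_envelope_def)
  have "(x, s + inverse (real (Suc n))) \<in> ?C" for n
  proof -
    have "Inf (ereal ` {t. (x, t) \<in> ?C}) < ereal (s + inverse (real (Suc n)))"
      by (rule le_less_trans [OF le]) (simp del: of_nat_Suc)
    then obtain t where "(x, t) \<in> ?C" "t < s + inverse (real (Suc n))"
      unfolding Inf_less_iff by (force simp del: of_nat_Suc)
    then show ?thesis
      by (rule closed_convex_hull_epigraph_upward [OF _ less_imp_le])
  qed
  moreover have "(\<lambda>n. (x, s + inverse (real (Suc n)))) \<longlonglongrightarrow> (x, s + 0)"
    by (intro tendsto_Pair tendsto_add tendsto_const LIMSEQ_inverse_real_of_nat)
  ultimately have "(x, s + 0) \<in> ?C"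
    by (rule closed_sequentially [OF closed_closure])
  then show "p \<in> ?C" by (simp add: p)
qed

lemma ereal_epigraph_inject: "ereal_epigraph f = ereal_epigraph g \<longleftrightarrow> f = g"
proof
  assume eq: "ereal_epigraph f = ereal_epigraph g"
  have iff: "f x \<le> ereal t \<longleftrightarrow> g x \<le> ereal t" for x t
    using eq by (auto simp: ereal_epigraph_def set_eq_iff)
  show "f = g"
  proof
    fix x
    show "f x = g x"
      by (rule antisym; rule ereal_le_real) (simp_all add: iff)
  qed
qed simp

end

theory Submission imports Defs begin

text \<open>
  Everything takes place on the domain \<open>D\<close> of \<open>f\<close>, where \<open>f\<close> is a real function \<open>\<phi>\<close>. Cut the
  segment from \<open>x \<in> D\<close> to \<open>y \<in> D\<close> into \<open>N = 2 ^ n\<close> equal parts, of length less than \<open>\<epsilon>\<close> and at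
  least \<open>\<epsilon> / 2\<close>. Repeated midpoints keep all the cutting points in \<open>D\<close>, and every second
  difference of the values of \<open>\<phi>\<close> at them is at least \<open>2 * \<delta>\<close>, since points two steps apart are
  at distance at least \<open>\<epsilon>\<close>. Summing twice,
  \<open>\<phi> y \<ge> \<phi> x + N * (\<phi> z - \<phi> x) + \<delta> * N * (N - 1)\<close> where \<open>z\<close> is the first cutting point,
  at distance less than \<open>\<epsilon>\<close> from \<open>x\<close>, and \<open>N\<close> is comparable to \<open>norm (y - x) / \<epsilon>\<close>
  (\<open>segment_growth\<close>).

  For the growth of \<open>f\<close>, fix \<open>x\<close>. The inequality is a quadratic lower bound as soon as
  \<open>\<phi> z\<close> is bounded below for \<open>z\<close> in the \<open>\<epsilon>\<close>-ball around \<open>x\<close>. This is what properness of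
  the envelope provides: its epigraph is closed and convex and misses some point \<open>(x, s)\<close>, hence a
  neighbourhood of it, and by convexity a bound near \<open>x\<close> propagates to every ball around \<open>x\<close>
  (\<open>closed_convex_epigraph_locally_bounded_below\<close>).

  For the localization of minimizers, add \<open>x\<^sub>0\<^sup>*\<close> to \<open>\<phi>\<close>, which does not change midpoint
  inequalities, and start the segment at a \<open>\<delta> / 2\<close>-minimizer \<open>x\<^sub>0\<close>. Now
  \<open>\<phi> z - \<phi> x\<^sub>0 \<ge> - \<delta> / 2\<close>, so \<open>\<phi>\<close> exceeds \<open>\<phi> x\<^sub>0\<close> by more than
  \<open>\<delta> / (2 * \<epsilon>)\<close> times the distance at every point at distance at least \<open>\<epsilon>\<close>
  (\<open>near_minimizer_linear_growth\<close>). A linear perturbation of smaller norm cannot move a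
  minimizer there.

  If \<open>f\<close> is its own envelope, it is convex and lower semicontinuous. Ekeland's principle, which needs
  completeness, yields \<open>x\<close> minimizing \<open>\<phi> + \<eta> * norm (\<cdot> - x)\<close> (\<open>ekeland_minimizer\<close>), and the
  Hahn-Banach theorem replaces the cone \<open>\<eta> * norm (\<cdot> - x)\<close> by a linear functional of norm at most
  \<open>\<eta>\<close> (\<open>subgradient_from_cone_minorant\<close>).
\<close>

section \<open>Growth along segments\<close>

text \<open>
  Uniform convexity at scale \<open>\<epsilon>\<close> of the extended-real function that is \<open>\<phi>\<close> on \<open>D\<close> and
  \<open>\<infinity>\<close> elsewhere, with the constant \<open>\<delta>\<close> explicit: membership of the midpoint in \<open>D\<close> says
  that the value there is finite.
\<close>
definition midpoint_drop_on :: "'a::real_normed_vector set \<Rightarrow> ('a \<Rightarrow> real) \<Rightarrow> real \<Rightarrow> real \<Rightarrow> bool" where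
  "midpoint_drop_on D \<phi> \<epsilon> \<delta> \<longleftrightarrow>
     (\<forall>x\<in>D. \<forall>y\<in>D. \<epsilon> \<le> norm (x - y) \<longrightarrow>
        (1/2) *\<^sub>R (x + y) \<in> D \<and> \<phi> ((1/2) *\<^sub>R (x + y)) \<le> (\<phi> x + \<phi> y) / 2 - \<delta>)"

lemma second_differences_quadratic_growth:
  fixes h :: "nat \<Rightarrow> real"
  assumes "\<And>k. Suc k < N \<Longrightarrow> 2 * h (Suc k) + 2 * \<delta> \<le> h k + h (Suc (Suc k))"
    and "k < N"
  shows "h 0 + real (Suc k) * (h 1 - h 0) + \<delta> * real (Suc k) * real k \<le> h (Suc k)"
proof -
  have slope: "h 1 - h 0 + 2 * \<delta> * real j \<le> h (Suc j) - h j" if "j < N" for j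
    using that
  proof (induction j)
    case (Suc j)
    then show ?case using assms(1)[of j] by (simp add: algebra_simps)
  qed simp
  show "h 0 + real (Suc k) * (h 1 - h 0) + \<delta> * real (Suc k) * real k \<le> h (Suc k)"
    using assms(2)
  proof (induction k)
    case (Suc k)
    then show ?case using slope[of "Suc k"] by (simp add: algebra_simps)
  qed simp
qed

lemma midpoint_on_line:
  fixes x v :: "'a::real_vector"
  shows "(1/2) *\<^sub>R ((x + a *\<^sub>R v) + (x + b *\<^sub>R v)) = x + ((a + b) / 2) *\<^sub>R v"
proof -
  have "(x + a *\<^sub>R v) + (x + b *\<^sub>R v) = 2 *\<^sub>R x + (a + b) *\<^sub>R v"
    by (simp add: scaleR_2 scaleR_add_left)
  then show ?thesis by (simp add: scaleR_add_right)
qed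

text \<open>
  Bisection can go on as long as the two points to be averaged are at distance at least \<open>\<epsilon>\<close>.
  In the last of \<open>n\<close> rounds they are \<open>norm (y - x) / 2 ^ (n - 1)\<close> apart.
\<close>
lemma dyadic_points_in_domain:
  assumes drop: "midpoint_drop_on D \<phi> \<epsilon> \<delta>"
    and "x \<in> D" "y \<in> D" "\<epsilon> > 0" "2 ^ n * \<epsilon> \<le> 2 * norm (y - x)" "k \<le> 2 ^ n"
  shows "x + (real k / 2 ^ n) *\<^sub>R (y - x) \<in> D"
  using assms(5,6)
proof (induction n arbitrary: k)
  case 0
  then have "k = 0 \<or> k = 1" by auto
  then show ?case using assms(2,3) by auto
next
  case (Suc n)
  let ?p = "\<lambda>j. x + (real j / 2 ^ n) *\<^sub>R (y - x)"
  have "2 ^ n * \<epsilon> \<le> 2 ^ Suc n * \<epsilon>" using assms(4) by simp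
  then have IH: "?p j \<in> D" if "j \<le> 2 ^ n" for j
    using Suc.IH[OF _ that] Suc.prems(1) by linarith
  show ?case
  proof (cases "even k")
    case True
    then obtain j where j: "k = 2 * j" by blast
    then have "j \<le> 2 ^ n" using Suc.prems(2) by simp
    then show ?thesis using IH[of j] j by simp
  next
    case False
    then obtain j where j: "k = 2 * j + 1" using oddE by blast
    then have jn: "j + 1 \<le> 2 ^ n" using Suc.prems(2) by simp
    have "?p (j + 1) - ?p j = (1 / 2 ^ n) *\<^sub>R (y - x)"
      by (simp add: scaleR_left_diff_distrib[symmetric] diff_divide_distrib[symmetric])
    then have "norm (?p (j + 1) - ?p j) = norm (y - x) / 2 ^ n"
      by (simp add: divide_inverse)
    moreover have "\<epsilon> \<le> norm (y - x) / 2 ^ n"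
      using Suc.prems(1) by (simp add: field_simps)
    ultimately have "(1/2) *\<^sub>R (?p (j + 1) + ?p j) \<in> D"
      using drop IH[of j] IH[of "j + 1"] jn unfolding midpoint_drop_on_def by auto
    moreover have "(real (j + 1) / 2 ^ n + real j / 2 ^ n) / 2 = real k / 2 ^ Suc n"
      by (simp add: j add_divide_distrib)
    ultimately show ?thesis by (simp only: midpoint_on_line)
  qed
qed

lemma exists_scale_power_of_two:
  fixes L \<epsilon> :: real
  assumes "0 < \<epsilon>" "\<epsilon> \<le> L"
  obtains n where "L < 2 ^ Suc n * \<epsilon>" "2 ^ n * \<epsilon> \<le> L"
proof -
  obtain m :: nat where "L / \<epsilon> < 2 ^ m" using real_arch_pow[of 2 "L / \<epsilon>"] by auto
  then have ex: "L < 2 ^ m * \<epsilon>" using assms by (simp add: field_simps)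
  define m0 where "m0 = (LEAST m. L < 2 ^ m * \<epsilon>)"
  have m0: "L < 2 ^ m0 * \<epsilon>" unfolding m0_def by (rule LeastI) (rule ex)
  then obtain n where n: "m0 = Suc n" using assms by (cases m0) auto
  then have "\<not> L < 2 ^ n * \<epsilon>" using not_less_Least[of n "\<lambda>m. L < 2 ^ m * \<epsilon>"] m0_def by simp
  then show ?thesis using that m0 n by auto
qed

text \<open>
  Equally spaced values with second differences at least \<open>2 * \<delta>\<close> grow quadratically. The step
  lies between \<open>\<epsilon> / 2\<close> and \<open>\<epsilon>\<close>: the lower bound makes the midpoint inequality
  apply to neighbours of a cutting point, the upper bound keeps \<open>z\<close> close to \<open>x\<close> and makes \<open>N\<close>
  large.
\<close>
lemma segment_growth:
  assumes drop: "midpoint_drop_on D \<phi> \<epsilon> \<delta>"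
    and xy: "x \<in> D" "y \<in> D" and \<epsilon>: "0 < \<epsilon>" "\<epsilon> \<le> norm (y - x)"
  obtains N z where "2 \<le> N" "N * \<epsilon> \<le> 2 * norm (y - x)" "norm (y - x) < N * \<epsilon>"
    "z \<in> D" "norm (z - x) < \<epsilon>" "\<phi> x + N * (\<phi> z - \<phi> x) + \<delta> * N * (N - 1) \<le> \<phi> y"
proof -
  obtain n where n: "norm (y - x) < 2 ^ Suc n * \<epsilon>" "2 ^ n * \<epsilon> \<le> norm (y - x)"
    using exists_scale_power_of_two[OF \<epsilon>] by blast
  \<comment> \<open>One more halving than the distance allows for the endpoints: only every second point has to be
    at distance \<open>\<epsilon>\<close>, and the power of two stays at least \<open>2\<close>.\<close>
  define N :: nat where "N = 2 ^ Suc n"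
  define p where "p = (\<lambda>k::nat. x + (real k / real N) *\<^sub>R (y - x))"
  have N: "2 \<le> N" by (simp add: N_def)
  have pD: "p k \<in> D" if "k \<le> N" for k
    using dyadic_points_in_domain[OF drop xy \<epsilon>(1), of "Suc n" k] n(2) that
    by (simp add: p_def N_def)
  have "2 * \<phi> (p (Suc k)) + 2 * \<delta> \<le> \<phi> (p k) + \<phi> (p (Suc (Suc k)))" if "Suc k < N" for k
  proof -
    have diff: "p (Suc (Suc k)) - p k = (2 / real N) *\<^sub>R (y - x)"
      by (simp add: p_def scaleR_left_diff_distrib[symmetric] diff_divide_distrib[symmetric])
    have "norm (p (Suc (Suc k)) - p k) = norm (y - x) / 2 ^ n"
      unfolding diff by (simp add: N_def)
    also have "\<epsilon> \<le> \<dots>" using n(2) by (simp add: field_simps)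
    finally have far: "\<epsilon> \<le> norm (p (Suc (Suc k)) - p k)" .
    have "(real (Suc (Suc k)) / real N + real k / real N) / 2 = real (Suc k) / real N"
      using N by (simp add: field_simps)
    then have "(1/2) *\<^sub>R (p (Suc (Suc k)) + p k) = p (Suc k)"
      by (simp only: p_def midpoint_on_line)
    then have "\<phi> (p (Suc k)) \<le> (\<phi> (p (Suc (Suc k))) + \<phi> (p k)) / 2 - \<delta>"
      using drop far pD[of k] pD[of "Suc (Suc k)"] that unfolding midpoint_drop_on_def by fastforce
    then show ?thesis by (simp add: field_simps)
  qed
  from second_differences_quadratic_growth[of N "\<lambda>k. \<phi> (p k)" \<delta> "N - 1", OF this]
  have "\<phi> (p 0) + real N * (\<phi> (p 1) - \<phi> (p 0)) + \<delta> * real N * (real N - 1) \<le> \<phi> (p N)"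
    using N by (simp add: of_nat_diff)
  moreover have "p 0 = x" "p N = y" using N by (simp_all add: p_def)
  moreover have "norm (p 1 - x) = norm (y - x) / real N" by (simp add: p_def)
  then have "norm (p 1 - x) < \<epsilon>"
    using n(1) N by (simp add: pos_divide_less_eq N_def mult.commute)
  moreover have "p 1 \<in> D" using pD N by simp
  ultimately show ?thesis
    using that[of "real N" "p 1"] N n by (simp add: N_def)
qed

lemma quadratic_growth_from_local_bound:
  assumes drop: "midpoint_drop_on D \<phi> \<epsilon> \<delta>"
    and "x \<in> D" "y \<in> D" "0 < \<epsilon>" "0 < \<delta>" "\<epsilon> \<le> norm (y - x)"
    and loc: "\<And>z. z \<in> D \<Longrightarrow> norm (z - x) < \<epsilon> \<Longrightarrow> \<phi> x - K \<le> \<phi> z"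
  shows "\<phi> x + \<delta> / \<epsilon>\<^sup>2 * (norm (y - x))\<^sup>2 - 2 * (K + \<delta>) / \<epsilon> * norm (y - x) \<le> \<phi> y"
proof -
  let ?L = "norm (y - x)"
  have K: "0 \<le> K" using loc[OF \<open>x \<in> D\<close>] \<open>0 < \<epsilon>\<close> by simp
  obtain N z where N: "2 \<le> N" "N * \<epsilon> \<le> 2 * ?L" "?L < N * \<epsilon>"
    and z: "z \<in> D" "norm (z - x) < \<epsilon>"
    and grow: "\<phi> x + N * (\<phi> z - \<phi> x) + \<delta> * N * (N - 1) \<le> \<phi> y"
    using segment_growth[OF drop assms(2-4,6)] by blast
  have "- (N * K) \<le> N * (\<phi> z - \<phi> x)"
    using mult_left_mono[of "- K" "\<phi> z - \<phi> x" N] loc[OF z] N(1) by simp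
  with grow have 1: "\<phi> x + \<delta> * N\<^sup>2 - (K + \<delta>) * N \<le> \<phi> y"
    by (simp add: power2_eq_square algebra_simps)
  have "(?L / \<epsilon>)\<^sup>2 \<le> N\<^sup>2"
    using N \<open>0 < \<epsilon>\<close> by (intro power_mono) (auto simp: field_simps)
  then have 2: "\<delta> / \<epsilon>\<^sup>2 * ?L\<^sup>2 \<le> \<delta> * N\<^sup>2"
    using mult_left_mono[of "(?L / \<epsilon>)\<^sup>2" "N\<^sup>2" \<delta>] \<open>0 < \<delta>\<close> by (simp add: power_divide)
  have "N \<le> 2 * ?L / \<epsilon>" using N(2) \<open>0 < \<epsilon>\<close> by (simp add: field_simps)
  then have "(K + \<delta>) * N \<le> (K + \<delta>) * (2 * ?L / \<epsilon>)"
    using K \<open>0 < \<delta>\<close> by (intro mult_left_mono) auto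
  also have "\<dots> = 2 * (K + \<delta>) / \<epsilon> * ?L" by simp
  finally show ?thesis using 1 2 by linarith
qed

text \<open>
  In \<open>segment_growth\<close> the first step loses at most \<open>\<delta> / 2\<close>, so the gain is at least
  \<open>N * (\<delta> * (N - 1) - \<delta> / 2) \<ge> N * \<delta> / 2\<close> because \<open>N \<ge> 2\<close>, while the distance is less than
  \<open>N * \<epsilon>\<close>. The constants depend on \<open>\<epsilon>\<close> and \<open>\<delta>\<close> only, which makes the localization of
  minimizers uniform in the functional.
\<close>
lemma near_minimizer_linear_growth:
  assumes drop: "midpoint_drop_on D \<phi> \<epsilon> \<delta>"
    and "x \<in> D" "y \<in> D" "0 < \<epsilon>" "0 < \<delta>" "\<epsilon> \<le> norm (y - x)"
    and near: "\<And>z. z \<in> D \<Longrightarrow> \<phi> x - \<delta> / 2 \<le> \<phi> z"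
  shows "\<phi> x + \<delta> / (2 * \<epsilon>) * norm (y - x) < \<phi> y"
proof -
  obtain N z where N: "2 \<le> N" "N * \<epsilon> \<le> 2 * norm (y - x)" "norm (y - x) < N * \<epsilon>"
    and z: "z \<in> D" "norm (z - x) < \<epsilon>"
    and grow: "\<phi> x + N * (\<phi> z - \<phi> x) + \<delta> * N * (N - 1) \<le> \<phi> y"
    using segment_growth[OF drop assms(2-4,6)] by blast
  have "\<delta> / (2 * \<epsilon>) * norm (y - x) < \<delta> / (2 * \<epsilon>) * (N * \<epsilon>)"
    using N \<open>0 < \<epsilon>\<close> \<open>0 < \<delta>\<close> by (intro mult_strict_left_mono) auto
  also have "\<dots> = N * (\<delta> / 2)" using \<open>0 < \<epsilon>\<close> by simp
  also have "\<dots> \<le> N * ((\<phi> z - \<phi> x) + \<delta> * (N - 1))"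
  proof (rule mult_left_mono)
    have "\<delta> * 1 \<le> \<delta> * (N - 1)" using N \<open>0 < \<delta>\<close> by (intro mult_left_mono) auto
    then show "\<delta> / 2 \<le> (\<phi> z - \<phi> x) + \<delta> * (N - 1)" using near[OF z(1)] by linarith
  qed (use N in simp)
  also have "\<dots> \<le> \<phi> y - \<phi> x" using grow by (simp add: algebra_simps)
  finally show ?thesis by simp
qed

section \<open>Coercivity\<close>

text \<open>
  A ball of radius \<open>r\<close> around \<open>(x, s)\<close> misses \<open>C\<close>. A point \<open>(y, t) \<in> C\<close> with \<open>t\<close> very
  negative would be joined to \<open>(x, T)\<close> by a segment passing below height \<open>s\<close> while still within
  distance \<open>r\<close> of \<open>x\<close>; upward closure of \<open>C\<close> then puts a point of that ball into \<open>C\<close>. The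
  resulting bound plays the part of an affine minorant.
\<close>
lemma closed_convex_epigraph_locally_bounded_below:
  fixes C :: "('a::real_normed_vector \<times> real) set"
  assumes "closed C" "convex C" "(x, T) \<in> C" "(x, s) \<notin> C"
    and up: "\<And>y t t'. (y, t) \<in> C \<Longrightarrow> t \<le> t' \<Longrightarrow> (y, t') \<in> C"
  shows "\<exists>K. \<forall>(y, t) \<in> C. norm (y - x) < R \<longrightarrow> T - K \<le> t"
proof (cases "R > 0")
  case True
  have "open (- C)" using assms(1) by (rule open_Compl)
  then obtain r where r: "0 < r" "ball (x, s) r \<subseteq> - C"
    using assms(4) by (metis ComplI open_contains_ball)
  define l where "l = min 1 (r / R)"
  have l: "0 < l" "l \<le> 1" "l * R \<le> r"
    using r True by (auto simp: l_def min_def field_simps)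
  have "T - (T - s) / l \<le> t" if yt: "(y, t) \<in> C" and near: "norm (y - x) < R" for y t
  proof -
    have "(1 - l) *\<^sub>R (x, T) + l *\<^sub>R (y, t) \<in> C"
      using convexD[OF assms(2,3) yt, of "1 - l" l] l by simp
    then have inC: "(x + l *\<^sub>R (y - x), (1 - l) * T + l * t) \<in> C"
      by (simp add: algebra_simps)
    have "dist x (x + l *\<^sub>R (y - x)) = l * norm (y - x)"
      using l by (simp add: dist_norm)
    also have "\<dots> < l * R" using near l by simp
    also have "\<dots> \<le> r" by (rule l)
    finally have "dist x (x + l *\<^sub>R (y - x)) < r" .
    then have "(x + l *\<^sub>R (y - x), s) \<in> ball (x, s) r" by (simp add: dist_Pair_Pair)
    then have "(x + l *\<^sub>R (y - x), s) \<notin> C" using r(2) by blast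
    then have "s < (1 - l) * T + l * t" using up[OF inC, of s] by fastforce
    then show ?thesis using l by (simp add: field_simps)
  qed
  then show ?thesis by (intro exI[of _ "(T - s) / l"]) auto
next
  case False
  then have "\<not> norm (y - x) < R" for y using norm_ge_zero[of "y - x"] by linarith
  then show ?thesis by auto
qed

lemma quadratic_beats_linear:
  fixes a b e :: real
  assumes "0 < a"
  obtains R where "\<And>L. R \<le> L \<Longrightarrow> a / 2 * L\<^sup>2 \<le> e + a * L\<^sup>2 - b * L"
proof
  define R where "R = 2 * (\<bar>b\<bar> + \<bar>e\<bar>) / a + 1"
  fix L assume L: "R \<le> L"
  have "1 \<le> R" using assms by (simp add: R_def)
  then have L1: "1 \<le> L" using L by simp
  have "2 * (\<bar>b\<bar> + \<bar>e\<bar>) / a \<le> L" using L by (simp add: R_def)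
  then have "\<bar>b\<bar> + \<bar>e\<bar> \<le> a / 2 * L" using assms by (simp add: field_simps)
  then have "(\<bar>b\<bar> + \<bar>e\<bar>) * L \<le> a / 2 * L * L" using L1 by (intro mult_right_mono) auto
  moreover have "b * L \<le> \<bar>b\<bar> * L" using L1 by (intro mult_right_mono) auto
  moreover have "\<bar>e\<bar> * 1 \<le> \<bar>e\<bar> * L" using L1 by (intro mult_left_mono) auto
  ultimately have "b * L - e \<le> a / 2 * L * L" by (simp add: algebra_simps)
  then show "a / 2 * L\<^sup>2 \<le> e + a * L\<^sup>2 - b * L"
    by (simp add: power2_eq_square field_simps)
qed

text \<open>
  Inside the \<open>\<epsilon>\<close>-ball around \<open>x\<close> the lower bound is the hypothesis, outside it is the minimum of
  the quadratic minorant. Half of the quadratic coefficient absorbs the linear term, and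
  passing from \<open>norm (y - x)\<close> to \<open>norm y\<close> costs another factor \<open>4\<close>, whence \<open>a / 8\<close>.
\<close>
lemma quadratic_growth_and_lower_bound:
  fixes D :: "'a::real_normed_vector set"
  assumes drop: "midpoint_drop_on D \<phi> \<epsilon> \<delta>" and "x \<in> D" "0 < \<epsilon>" "0 < \<delta>"
    and loc: "\<And>z. z \<in> D \<Longrightarrow> norm (z - x) < \<epsilon> \<Longrightarrow> \<phi> x - K \<le> \<phi> z"
  shows "\<exists>m. \<forall>y\<in>D. m \<le> \<phi> y"
    and "\<exists>c>0. \<exists>R. \<forall>y\<in>D. R \<le> norm y \<longrightarrow> c * (norm y)\<^sup>2 \<le> \<phi> y"
proof -
  define a b where "a = \<delta> / \<epsilon>\<^sup>2" and "b = 2 * (K + \<delta>) / \<epsilon>"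
  have a: "0 < a" using assms by (simp add: a_def)
  have quad: "\<phi> x + a * (norm (y - x))\<^sup>2 - b * norm (y - x) \<le> \<phi> y"
    if "y \<in> D" "\<epsilon> \<le> norm (y - x)" for y
    using quadratic_growth_from_local_bound[OF drop \<open>x \<in> D\<close> that(1) assms(3,4) that(2) loc]
    by (simp add: a_def b_def)
  have "min (\<phi> x - K) (\<phi> x - b\<^sup>2 / (4 * a)) \<le> \<phi> y" if "y \<in> D" for y
  proof (cases "norm (y - x) < \<epsilon>")
    case True
    then show ?thesis using loc[OF that] by simp
  next
    case False
    let ?L = "norm (y - x)"
    have "0 \<le> a * (?L - b / (2 * a))\<^sup>2" using a by simp
    also have "\<dots> = a * ?L\<^sup>2 - b * ?L + b\<^sup>2 / (4 * a)"
      using a by (simp add: power2_eq_square field_simps)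
    finally show ?thesis using quad[OF that] False by (simp add: min_def)
  qed
  then show "\<exists>m. \<forall>y\<in>D. m \<le> \<phi> y" by blast
  obtain R where R: "\<And>L. R \<le> L \<Longrightarrow> a / 2 * L\<^sup>2 \<le> \<phi> x + a * L\<^sup>2 - b * L"
    using quadratic_beats_linear[OF a] by metis
  have "a / 8 * (norm y)\<^sup>2 \<le> \<phi> y"
    if y: "y \<in> D" and big: "2 * norm x + 2 * \<bar>R\<bar> + 2 * \<epsilon> \<le> norm y" for y
  proof -
    have half: "norm y / 2 \<le> norm (y - x)"
      using norm_triangle_ineq2[of y x] big assms(3) by linarith
    have "R \<le> norm (y - x)" "\<epsilon> \<le> norm (y - x)"
      using half big norm_ge_zero[of x] assms(3) by linarith+
    then have "a / 2 * (norm (y - x))\<^sup>2 \<le> \<phi> y" using R quad[OF y] by force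
    moreover have "(norm y / 2)\<^sup>2 \<le> (norm (y - x))\<^sup>2" using half by (intro power_mono) auto
    then have "a / 2 * (norm y / 2)\<^sup>2 \<le> a / 2 * (norm (y - x))\<^sup>2"
      using a by (intro mult_left_mono) auto
    ultimately show ?thesis by (simp add: power_divide)
  qed
  then show "\<exists>c>0. \<exists>R. \<forall>y\<in>D. R \<le> norm y \<longrightarrow> c * (norm y)\<^sup>2 \<le> \<phi> y"
    using a by (intro exI[of _ "a / 8"] conjI exI[of _ "2 * norm x + 2 * \<bar>R\<bar> + 2 * \<epsilon>"]) auto
qed

section \<open>Ekeland's variational principle\<close>

text \<open>
  Order \<open>D\<close> by letting \<open>S x\<close> be the set of points that improve on \<open>x\<close> by at least \<open>\<eta>\<close> times the
  distance; a point with \<open>S x = {x}\<close> is as wanted. Choosing \<open>u (Suc n)\<close> almost minimal in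
  \<open>S (u n)\<close> shrinks these nested sets to radius \<open>(1/2) ^ n\<close>. The limit of \<open>u\<close> lies in all of them,
  because the epigraph is closed, so the set of this limit has radius \<open>0\<close>.
\<close>
lemma ekeland_minimizer:
  fixes D :: "'a::complete_space set" and \<phi> :: "'a \<Rightarrow> real"
  assumes closed: "closed (epigraph D \<phi>)"
    and "D \<noteq> {}" and bdd: "\<And>x. x \<in> D \<Longrightarrow> m \<le> \<phi> x" and "0 < \<eta>"
  obtains x where "x \<in> D" "\<And>y. y \<in> D \<Longrightarrow> \<phi> x \<le> \<phi> y + \<eta> * dist y x"
proof -
  define S where "S x = {y \<in> D. \<phi> y + \<eta> * dist x y \<le> \<phi> x}" for x
  have S_refl: "x \<in> S x" if "x \<in> D" for x using that by (simp add: S_def)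
  have S_trans: "S y \<subseteq> S x" if "y \<in> S x" for x y
  proof
    fix z assume z: "z \<in> S y"
    have "\<eta> * dist x z \<le> \<eta> * (dist x y + dist y z)"
      using \<open>0 < \<eta>\<close> by (intro mult_left_mono dist_triangle) auto
    then show "z \<in> S x" using z that by (simp add: S_def distrib_left)
  qed
  have step: "\<exists>y. y \<in> S x \<and> (\<forall>z\<in>S x. \<phi> y \<le> \<phi> z + \<eta> * (1/2) ^ n)" if "x \<in> D" for x n
  proof -
    have ne: "\<phi> ` S x \<noteq> {}" using S_refl[OF that] by blast
    have bb: "bdd_below (\<phi> ` S x)" using bdd by (auto simp: S_def intro!: bdd_belowI[of _ m])
    have "Inf (\<phi> ` S x) < Inf (\<phi> ` S x) + \<eta> * (1/2) ^ n" using \<open>0 < \<eta>\<close> by simp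
    then obtain y where y: "y \<in> S x" "\<phi> y < Inf (\<phi> ` S x) + \<eta> * (1/2) ^ n"
      using cInf_lessD[OF ne] by blast
    have "\<phi> y \<le> \<phi> z + \<eta> * (1/2) ^ n" if "z \<in> S x" for z
      using cInf_lower[OF imageI[OF that] bb] y(2) by linarith
    then show ?thesis using y(1) by blast
  qed
  have "\<exists>u. \<forall>n. u n \<in> D \<and>
      (u (Suc n) \<in> S (u n) \<and> (\<forall>z\<in>S (u n). \<phi> (u (Suc n)) \<le> \<phi> z + \<eta> * (1/2) ^ n))"
  proof (rule dependent_nat_choice)
    show "\<exists>x. x \<in> D" using \<open>D \<noteq> {}\<close> by blast
    fix x n assume "x \<in> D"
    then show "\<exists>y. y \<in> D \<and> (y \<in> S x \<and> (\<forall>z\<in>S x. \<phi> y \<le> \<phi> z + \<eta> * (1/2) ^ n))"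
      using step[of x n] by (auto simp: S_def)
  qed
  then obtain u where uD: "\<And>n. u n \<in> D" and uS: "\<And>n. u (Suc n) \<in> S (u n)"
    and umin: "\<And>n z. z \<in> S (u n) \<Longrightarrow> \<phi> (u (Suc n)) \<le> \<phi> z + \<eta> * (1/2) ^ n"
    by blast
  have mono: "S (u k) \<subseteq> S (u n)" if "n \<le> k" for n k
    using that by (induction rule: dec_induct) (use S_trans[OF uS] in blast)+
  have small: "dist (u (Suc n)) z \<le> (1/2) ^ n" if "z \<in> S (u (Suc n))" for n z
  proof -
    have "\<phi> (u (Suc n)) \<le> \<phi> z + \<eta> * (1/2) ^ n"
      using umin mono[of n "Suc n"] that by auto
    then have "\<eta> * dist (u (Suc n)) z \<le> \<eta> * (1/2) ^ n"
      using that by (simp add: S_def)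
    then show ?thesis using \<open>0 < \<eta>\<close> by simp
  qed
  have tail: "u k \<in> S (u n)" if "n \<le> k" for n k
    using mono[OF that] S_refl[OF uD] by blast
  have null: "(\<lambda>n. (1/2::real) ^ n) \<longlonglongrightarrow> 0" by (simp add: LIMSEQ_power_zero)
  have "Cauchy u"
    unfolding Cauchy_altdef2
  proof (intro allI impI)
    fix e :: real assume "0 < e"
    then obtain n where "(1/2::real) ^ n < e" using real_arch_pow_inv[of e "1/2"] by auto
    then have "\<forall>k\<ge>Suc n. dist (u k) (u (Suc n)) < e"
      using small tail by (metis dist_commute le_less_trans)
    then show "\<exists>N. \<forall>n\<ge>N. dist (u n) (u N) < e" by blast
  qed
  then obtain x where x: "u \<longlonglongrightarrow> x" using Cauchy_convergent convergent_def by blast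
  have xS: "x \<in> S (u n)" for n
  proof -
    have lim: "(\<lambda>k. (u (k + n), \<phi> (u n) - \<eta> * dist (u n) (u (k + n))))
        \<longlonglongrightarrow> (x, \<phi> (u n) - \<eta> * dist (u n) x)"
      using LIMSEQ_ignore_initial_segment[OF x, of n] by (intro tendsto_intros)
    have "(u (k + n), \<phi> (u n) - \<eta> * dist (u n) (u (k + n))) \<in> epigraph D \<phi>" for k
      using tail[of n "k + n"] by (simp add: S_def epigraph_def)
    from closed_sequentially[OF closed this lim] show ?thesis by (simp add: S_def epigraph_def)
  qed
  have "y = x" if "y \<in> S x" for y
  proof -
    have y: "y \<in> S (u (Suc n))" for n using S_trans[OF xS] that by blast
    have "(\<lambda>n. u (Suc n)) \<longlonglongrightarrow> y"
      by (rule tendstoI, rule eventually_mono[OF order_tendstoD(2)[OF null]])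
        (auto intro: le_less_trans[OF small[OF y]])
    then show ?thesis using LIMSEQ_unique LIMSEQ_Suc[OF x] by blast
  qed
  then have "\<phi> x \<le> \<phi> y + \<eta> * dist y x" if "y \<in> D" for y
    using that by (cases "y = x") (force simp: S_def dist_commute)+
  moreover have "x \<in> D" using xS by (simp add: S_def)
  ultimately show ?thesis using that by blast
qed

section \<open>Subgradients by the Hahn-Banach theorem\<close>

text \<open>
  The inequality for positive factors is equivalent to homogeneity for nonnegative factors
  (\<open>sublinear_scaleR\<close>, \<open>sublinear_zero\<close>) and is easier to establish for infima.
\<close>
definition sublinear :: "('a::real_vector \<Rightarrow> real) \<Rightarrow> bool" where
  "sublinear s \<longleftrightarrow> (\<forall>x y. s (x + y) \<le> s x + s y) \<and> (\<forall>c>0. \<forall>x. s (c *\<^sub>R x) \<le> c * s x)"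

lemma sublinear_add: "sublinear s \<Longrightarrow> s (x + y) \<le> s x + s y"
  by (simp add: sublinear_def)

lemma sublinear_scaleR:
  assumes "sublinear s" "0 < c"
  shows "s (c *\<^sub>R x) = c * s x"
proof -
  have "s ((1 / c) *\<^sub>R (c *\<^sub>R x)) \<le> (1 / c) * s (c *\<^sub>R x)"
    using assms unfolding sublinear_def by (meson zero_less_divide_1_iff)
  then have "c * s x \<le> s (c *\<^sub>R x)" using assms(2) by (simp add: field_simps)
  then show ?thesis using assms unfolding sublinear_def by (meson antisym)
qed

lemma sublinear_zero: "sublinear s \<Longrightarrow> s 0 = 0"
  using sublinear_scaleR[of s 2 0] by simp

lemma sublinear_ge_neg: "sublinear s \<Longrightarrow> - s (- x) \<le> s x"
  using sublinear_add[of s x "- x"] sublinear_zero[of s] by simp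

lemma sublinear_Inf_chain:
  fixes C :: "('a::real_vector \<Rightarrow> real) set"
  assumes "C \<noteq> {}" and sub: "\<And>s. s \<in> C \<Longrightarrow> sublinear s"
    and chain: "\<And>s t. s \<in> C \<Longrightarrow> t \<in> C \<Longrightarrow> s \<le> t \<or> t \<le> s"
    and bdd: "\<And>x. bdd_below ((\<lambda>s. s x) ` C)"
  shows "sublinear (\<lambda>x. INF s\<in>C. s x)"
  unfolding sublinear_def
proof (intro conjI allI impI)
  note lower = cINF_lower[OF bdd] and greatest = cINF_greatest[OF \<open>C \<noteq> {}\<close>]
  fix x y
  have le: "(INF s\<in>C. s (x + y)) \<le> s1 x + s2 y" if s: "s1 \<in> C" "s2 \<in> C" for s1 s2
  proof -
    obtain s where "s \<in> C" "s \<le> s1" "s \<le> s2" using chain[OF s] s by blast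
    then show ?thesis
      using lower[of s "x + y"] sublinear_add[OF sub, of s x y] le_funD[of s s1 x] le_funD[of s s2 y]
      by linarith
  qed
  have "(INF s\<in>C. s (x + y)) - s2 y \<le> (INF s\<in>C. s x)" if "s2 \<in> C" for s2
    by (rule greatest) (use le[OF _ that] in force)
  then have "(INF s\<in>C. s (x + y)) - (INF s\<in>C. s x) \<le> (INF s\<in>C. s y)"
    by (intro greatest) force
  then show "(INF s\<in>C. s (x + y)) \<le> (INF s\<in>C. s x) + (INF s\<in>C. s y)" by linarith
next
  fix c :: real and x assume c: "0 < c"
  have "(INF s\<in>C. s (c *\<^sub>R x)) / c \<le> (INF s\<in>C. s x)"
  proof (rule cINF_greatest[OF \<open>C \<noteq> {}\<close>])
    fix s assume s: "s \<in> C"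
    have "(INF s\<in>C. s (c *\<^sub>R x)) \<le> c * s x"
      using cINF_lower[OF bdd s] sublinear_scaleR[OF sub[OF s] c] by metis
    then show "(INF s\<in>C. s (c *\<^sub>R x)) / c \<le> s x" using c by (simp add: field_simps)
  qed
  then show "(INF s\<in>C. s (c *\<^sub>R x)) \<le> c * (INF s\<in>C. s x)"
    using c by (simp add: field_simps)
qed

text \<open>
  The infimum of \<open>s (x + t *\<^sub>R v) - t * s v\<close> over \<open>t \<ge> 0\<close> is sublinear; \<open>t = 0\<close> shows that it is
  below \<open>s\<close> and \<open>t = 1\<close> that it detects every failure of additivity in direction \<open>v\<close>.
\<close>
lemma sublinear_lower_along:
  fixes s :: "'a::real_vector \<Rightarrow> real"
  assumes s: "sublinear s"
  obtains s' where "sublinear s'" "s' \<le> s" "\<And>x. s' x \<le> s (x + v) - s v"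
proof -
  define A where "A x = (\<lambda>t. s (x + t *\<^sub>R v) - t * s v) ` {0..}" for x
  have tv: "s (t *\<^sub>R v) = t * s v" if "0 \<le> t" for t
    using that sublinear_scaleR[OF s] sublinear_zero[OF s] by (cases "t = 0") auto
  have bdd: "bdd_below (A x)" for x
  proof (rule bdd_belowI)
    fix a assume "a \<in> A x"
    then obtain t where t: "0 \<le> t" "a = s (x + t *\<^sub>R v) - t * s v" by (auto simp: A_def)
    then show "- s (- x) \<le> a"
      using sublinear_add[OF s, of "x + t *\<^sub>R v" "- x"] tv[of t] by simp
  qed
  have ne: "A x \<noteq> {}" for x by (auto simp: A_def)
  have lower: "Inf (A x) \<le> s (x + t *\<^sub>R v) - t * s v" if "0 \<le> t" for x t
    using that by (intro cInf_lower[OF _ bdd]) (auto simp: A_def)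
  have "sublinear (\<lambda>x. Inf (A x))"
    unfolding sublinear_def
  proof (intro conjI allI impI)
    fix x y
    have "Inf (A (x + y)) \<le> a + b" if ab: "a \<in> A x" "b \<in> A y" for a b
    proof -
      obtain p where p: "0 \<le> p" "a = s (x + p *\<^sub>R v) - p * s v" using ab by (auto simp: A_def)
      obtain q where q: "0 \<le> q" "b = s (y + q *\<^sub>R v) - q * s v" using ab by (auto simp: A_def)
      have "x + y + (p + q) *\<^sub>R v = (x + p *\<^sub>R v) + (y + q *\<^sub>R v)"
        by (simp add: algebra_simps)
      then show ?thesis
        using lower[of "p + q" "x + y"] p q sublinear_add[OF s, of "x + p *\<^sub>R v" "y + q *\<^sub>R v"]
        by (simp add: algebra_simps)
    qed
    then have "Inf (A (x + y)) - b \<le> Inf (A x)" if "b \<in> A y" for b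
      using that by (intro cInf_greatest[OF ne]) force
    then have "Inf (A (x + y)) - Inf (A x) \<le> Inf (A y)"
      by (intro cInf_greatest[OF ne]) force
    then show "Inf (A (x + y)) \<le> Inf (A x) + Inf (A y)" by linarith
  next
    fix c :: real and x assume c: "0 < c"
    have "Inf (A (c *\<^sub>R x)) / c \<le> Inf (A x)"
    proof (rule cInf_greatest[OF ne])
      fix a assume "a \<in> A x"
      then obtain t where t: "0 \<le> t" "a = s (x + t *\<^sub>R v) - t * s v" by (auto simp: A_def)
      have "c *\<^sub>R x + (c * t) *\<^sub>R v = c *\<^sub>R (x + t *\<^sub>R v)" by (simp add: algebra_simps)
      then have "s (c *\<^sub>R x + (c * t) *\<^sub>R v) - c * t * s v = c * a"
        by (simp only: sublinear_scaleR[OF s c] t(2)) (simp add: algebra_simps)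
      then have "Inf (A (c *\<^sub>R x)) \<le> c * a"
        using lower[of "c * t" "c *\<^sub>R x"] t c by simp
      then show "Inf (A (c *\<^sub>R x)) / c \<le> a" using c by (simp add: field_simps)
    qed
    then show "Inf (A (c *\<^sub>R x)) \<le> c * Inf (A x)" using c by (simp add: field_simps)
  qed
  moreover have "(\<lambda>x. Inf (A x)) \<le> s" using lower[of 0] by (simp add: le_fun_def)
  moreover have "Inf (A x) \<le> s (x + v) - s v" for x using lower[of 1 x] by simp
  ultimately show ?thesis using that by blast
qed

lemma minimal_sublinear_imp_linear:
  fixes s :: "'a::real_vector \<Rightarrow> real"
  assumes s: "sublinear s" and min: "\<And>t. sublinear t \<Longrightarrow> t \<le> s \<Longrightarrow> t = s"
  shows "linear s"
proof -
  have add: "s (x + v) = s x + s v" for x v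
  proof -
    obtain s' where s': "sublinear s'" "s' \<le> s" "\<And>x. s' x \<le> s (x + v) - s v"
      using sublinear_lower_along[OF s] by blast
    have "s x \<le> s (x + v) - s v" using s'(3)[of x] min[OF s'(1,2)] by simp
    then show ?thesis using sublinear_add[OF s, of x v] by simp
  qed
  have neg: "s (- x) = - s x" for x
    using add[of x "- x"] sublinear_zero[OF s] by simp
  have "s (c *\<^sub>R x) = c *\<^sub>R s x" for c x
  proof (cases c "0::real" rule: linorder_cases)
    case less
    then show ?thesis using sublinear_scaleR[OF s, of "- c" x] neg[of "c *\<^sub>R x"] by simp
  qed (use sublinear_scaleR[OF s] sublinear_zero[OF s] in auto)
  with add show ?thesis by (rule linearI)
qed

text \<open>
  Working with sublinear functionals on the whole space instead of linear ones on subspaces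
  makes the chain condition of Zorn's lemma a statement about pointwise infima, which are finite
  because \<open>s x \<ge> - s (- x) \<ge> - q (- x)\<close> for sublinear \<open>s \<le> q\<close>.
\<close>
theorem hahn_banach_dominated:
  fixes q :: "'a::real_vector \<Rightarrow> real"
  assumes q: "sublinear q"
  obtains l where "linear l" "l \<le> q"
proof -
  let ?A = "{s. sublinear s \<and> s \<le> q}"
  let ?P = "\<lambda>s t :: 'a \<Rightarrow> real. t \<le> s"
  have "\<exists>m\<in>?A. \<forall>a\<in>?A. ?P m a \<longrightarrow> a = m"
  proof (rule predicate_Zorn)
    show "partial_order_on ?A (relation_of ?P ?A)"
      by (rule partial_order_on_relation_ofI) auto
    fix C assume "C \<in> Chains (relation_of ?P ?A)"
    then have sub: "C \<subseteq> ?A" and chain: "\<And>s t. s \<in> C \<Longrightarrow> t \<in> C \<Longrightarrow> s \<le> t \<or> t \<le> s"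
      by (auto simp: Chains_def relation_of_def)
    show "\<exists>u\<in>?A. \<forall>a\<in>C. ?P a u"
    proof (cases "C = {}")
      case True
      then show ?thesis using q by auto
    next
      case False
      have bdd: "bdd_below ((\<lambda>s. s x) ` C)" for x
      proof (rule bdd_belowI2)
        fix s assume "s \<in> C"
        then have "sublinear s" "s \<le> q" using sub by auto
        then show "- q (- x) \<le> s x"
          using sublinear_ge_neg[of s x] le_funD[of s q "- x"] by linarith
      qed
      have "sublinear (\<lambda>x. INF s\<in>C. s x)"
        using sublinear_Inf_chain[OF False _ chain bdd] sub by blast
      moreover have le: "(\<lambda>x. INF s\<in>C. s x) \<le> s" if "s \<in> C" for s
        using cINF_lower[OF bdd that] by (simp add: le_fun_def)
      moreover obtain s where "s \<in> C" using False by blast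
      ultimately show ?thesis using sub by (intro bexI[of _ "\<lambda>x. INF s\<in>C. s x"]) force+
    qed
  qed
  then obtain s where s: "sublinear s" "s \<le> q"
    and min: "\<And>t. sublinear t \<Longrightarrow> t \<le> q \<Longrightarrow> t \<le> s \<Longrightarrow> t = s"
    by blast
  have "linear s"
    using s min by (intro minimal_sublinear_imp_linear) (auto intro: order_trans)
  then show ?thesis using that s(2) by blast
qed

text \<open>
  The largest sublinear functional below both \<open>y - x \<mapsto> \<phi> y - \<phi> x\<close> and \<open>\<eta> * norm\<close> is their
  infimal convolution, after the former is made positively homogeneous by the factor \<open>c\<close>. The
  cone inequality bounds it below by \<open>- \<eta> * norm\<close>, so it is finite, and convexity of \<open>\<phi>\<close>
  makes it subadditive. A linear functional below it is the negative of the one wanted.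
\<close>
lemma subgradient_from_cone_minorant:
  fixes \<phi> :: "'a::real_normed_vector \<Rightarrow> real"
  assumes conv: "convex_on D \<phi>" and x: "x \<in> D" and "0 \<le> \<eta>"
    and cone: "\<And>y. y \<in> D \<Longrightarrow> \<phi> x \<le> \<phi> y + \<eta> * norm (y - x)"
  obtains p :: "'a \<Rightarrow>\<^sub>L real" where "norm p \<le> \<eta>" "\<And>y. y \<in> D \<Longrightarrow> \<phi> x \<le> \<phi> y + p (y - x)"
proof -
  define g where "g v y c = c * (\<phi> y - \<phi> x) + \<eta> * norm (v - c *\<^sub>R (y - x))" for v y and c :: real
  define A where "A v = {g v y c |y c. y \<in> D \<and> 0 \<le> c}" for v
  have gA: "g v y c \<in> A v" if "y \<in> D" "0 \<le> c" for v y c using that by (auto simp: A_def)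
  have bdd: "bdd_below (A v)" for v
  proof (rule bdd_belowI)
    fix a assume "a \<in> A v"
    then obtain y c where yc: "y \<in> D" "0 \<le> c" "a = g v y c" by (auto simp: A_def)
    have "c * (- (\<eta> * norm (y - x))) \<le> c * (\<phi> y - \<phi> x)"
      using cone[OF yc(1)] yc(2) by (intro mult_left_mono) auto
    moreover have "norm (c *\<^sub>R (y - x)) \<le> norm (v - c *\<^sub>R (y - x)) + norm v"
      using norm_triangle_sub[of "c *\<^sub>R (y - x)" v] by (simp add: norm_minus_commute)
    then have "\<eta> * (c * norm (y - x)) \<le> \<eta> * (norm (v - c *\<^sub>R (y - x)) + norm v)"
      using \<open>0 \<le> \<eta>\<close> yc(2) by (intro mult_left_mono) auto
    ultimately show "- (\<eta> * norm v) \<le> a" by (simp add: yc(3) g_def algebra_simps)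
  qed
  have ne: "A v \<noteq> {}" for v using gA[OF x, of 0 v] by auto
  have lower: "Inf (A v) \<le> g v y c" if "y \<in> D" "0 \<le> c" for v y c
    using cInf_lower[OF gA[OF that] bdd] .
  have "sublinear (\<lambda>v. Inf (A v))"
    unfolding sublinear_def
  proof (intro conjI allI impI)
    fix v w
    have "Inf (A (v + w)) \<le> a + b" if ab: "a \<in> A v" "b \<in> A w" for a b
    proof -
      obtain y c where yc: "y \<in> D" "0 \<le> c" "a = g v y c" using ab by (auto simp: A_def)
      obtain z d where zd: "z \<in> D" "0 \<le> d" "b = g w z d" using ab by (auto simp: A_def)
      \<comment> \<open>The average of \<open>y\<close> and \<open>z\<close> with weights \<open>c\<close> and \<open>d\<close>; any point serves if both vanish.\<close>
      obtain u where u: "u \<in> D" "(c + d) *\<^sub>R (u - x) = c *\<^sub>R (y - x) + d *\<^sub>R (z - x)"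
        "(c + d) * (\<phi> u - \<phi> x) \<le> c * (\<phi> y - \<phi> x) + d * (\<phi> z - \<phi> x)"
      proof (cases "c + d = 0")
        case True
        then have "c = 0" "d = 0" using yc zd by auto
        then show ?thesis using that[OF x] by simp
      next
        case False
        define r where "r = d / (c + d)"
        have cd: "0 < c + d" using False yc zd by simp
        then have r: "0 \<le> r" "r \<le> 1" "1 - r = c / (c + d)"
          using yc zd by (auto simp: r_def field_simps)
        let ?u = "(1 - r) *\<^sub>R y + r *\<^sub>R z"
        have cr: "(c + d) * (1 - r) = c" "(c + d) * r = d" using cd r by (auto simp: r_def)
        have "?u \<in> D"
          using convex_on_imp_convex[OF conv] yc zd r by (intro convexD) auto
        moreover have "(c + d) *\<^sub>R (?u - x) = c *\<^sub>R (y - x) + d *\<^sub>R (z - x)"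
        proof -
          have "(c + d) *\<^sub>R ?u = c *\<^sub>R y + d *\<^sub>R z"
            by (simp only: scaleR_add_right scaleR_scaleR cr)
          then show ?thesis by (simp add: scaleR_diff_right scaleR_add_left)
        qed
        moreover have "(c + d) * (\<phi> ?u - \<phi> x) \<le> c * (\<phi> y - \<phi> x) + d * (\<phi> z - \<phi> x)"
        proof -
          have "(c + d) * \<phi> ?u \<le> (c + d) * ((1 - r) * \<phi> y + r * \<phi> z)"
            using convex_onD[OF conv r(1,2) yc(1) zd(1)] cd by (intro mult_left_mono) auto
          also have "\<dots> = c * \<phi> y + d * \<phi> z"
            by (simp only: distrib_left mult.assoc[symmetric] cr)
          finally show ?thesis by (simp add: algebra_simps)
        qed
        ultimately show ?thesis using that by blast
      qed
      have "norm (v + w - (c + d) *\<^sub>R (u - x))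
          \<le> norm (v - c *\<^sub>R (y - x)) + norm (w - d *\<^sub>R (z - x))"
        unfolding u(2) using norm_triangle_ineq[of "v - c *\<^sub>R (y - x)" "w - d *\<^sub>R (z - x)"]
        by (simp add: algebra_simps)
      then have "\<eta> * norm (v + w - (c + d) *\<^sub>R (u - x))
          \<le> \<eta> * (norm (v - c *\<^sub>R (y - x)) + norm (w - d *\<^sub>R (z - x)))"
        using \<open>0 \<le> \<eta>\<close> by (rule mult_left_mono)
      then have "g (v + w) u (c + d) \<le> a + b"
        using u(3) by (simp add: g_def yc(3) zd(3) distrib_left)
      then show ?thesis using lower[OF u(1), of "c + d" "v + w"] yc zd by simp
    qed
    then have "Inf (A (v + w)) - b \<le> Inf (A v)" if "b \<in> A w" for b
      using that by (intro cInf_greatest[OF ne]) force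
    then have "Inf (A (v + w)) - Inf (A v) \<le> Inf (A w)"
      by (intro cInf_greatest[OF ne]) force
    then show "Inf (A (v + w)) \<le> Inf (A v) + Inf (A w)" by linarith
  next
    fix k :: real and v assume k: "0 < k"
    have "Inf (A (k *\<^sub>R v)) / k \<le> Inf (A v)"
    proof (rule cInf_greatest[OF ne])
      fix a assume "a \<in> A v"
      then obtain y c where yc: "y \<in> D" "0 \<le> c" "a = g v y c" by (auto simp: A_def)
      have "norm (k *\<^sub>R v - (k * c) *\<^sub>R (y - x)) = k * norm (v - c *\<^sub>R (y - x))"
        using k by (simp only: scaleR_scaleR[symmetric] scaleR_diff_right[symmetric]) simp
      then have "g (k *\<^sub>R v) y (k * c) = k * a"
        by (simp add: g_def yc(3) algebra_simps)
      then have "Inf (A (k *\<^sub>R v)) \<le> k * a"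
        using lower[OF yc(1), of "k * c" "k *\<^sub>R v"] yc k by simp
      then show "Inf (A (k *\<^sub>R v)) / k \<le> a" using k by (simp add: field_simps)
    qed
    then show "Inf (A (k *\<^sub>R v)) \<le> k * Inf (A v)" using k by (simp add: field_simps)
  qed
  then obtain l where l: "linear l" and le: "\<And>v. l v \<le> Inf (A v)"
    by (rule hahn_banach_dominated) (auto simp: le_fun_def)
  have l_norm: "l v \<le> \<eta> * norm v" for v
    using le[of v] lower[OF x, of 0 v] by (simp add: g_def)
  have l_abs: "\<bar>l v\<bar> \<le> \<eta> * norm v" for v
    using l_norm[of v] l_norm[of "- v"] linear_neg[OF l, of v] by (simp add: abs_le_iff)
  have bl: "bounded_linear (\<lambda>v. - l v)"
    using l l_abs
    by (intro bounded_linear_intro[of _ \<eta>]) (auto simp: linear_add linear_scale mult.commute)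
  define p where "p = Blinfun (\<lambda>v. - l v)"
  have p: "blinfun_apply p v = - l v" for v
    using bounded_linear_Blinfun_apply[OF bl] by (simp add: p_def)
  have "norm p \<le> \<eta>" by (rule norm_blinfun_bound) (use \<open>0 \<le> \<eta>\<close> l_abs p in auto)
  moreover have "\<phi> x \<le> \<phi> y + p (y - x)" if "y \<in> D" for y
    using le[of "y - x"] lower[OF that, of 1 "y - x"] by (simp add: g_def p)
  ultimately show ?thesis using that by blast
qed


section \<open>Extended-real functions on their domain\<close>

text \<open>
  \<open>real_of_ereal\<close> sends infinite values to \<open>0\<close>, so \<open>real_of_ereal (f x)\<close> is meaningful only
  for \<open>x\<close> in the domain; all real-valued statements below are guarded by \<open>f x < \<infinity>\<close>.
\<close>
lemma ereal_eq_real_on_domain: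
  assumes "proper_fun f" "f x < \<infinity>"
  shows "f x = ereal (real_of_ereal (f x))"
  using assms by (cases "f x") (auto simp: proper_fun_def dest: spec[of _ x])

lemma eps_uniformly_convex_midpoint_drop:
  assumes proper: "proper_fun f" and "eps_uniformly_convex \<epsilon> f"
  obtains \<delta> where "0 < \<delta>" "midpoint_drop_on {x. f x < \<infinity>} (\<lambda>x. real_of_ereal (f x)) \<epsilon> \<delta>"
proof -
  obtain \<delta> :: real where \<delta>: "0 < \<delta>"
    and uc: "\<And>x y. \<epsilon> \<le> norm (x - y) \<Longrightarrow> f ((1/2) *\<^sub>R (x + y)) \<le> (f x + f y) / 2 - ereal \<delta>"
    using assms(2) by (auto simp: eps_uniformly_convex_def)
  have "f ((1/2) *\<^sub>R (x + y)) < \<infinity> \<and>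
      real_of_ereal (f ((1/2) *\<^sub>R (x + y))) \<le> (real_of_ereal (f x) + real_of_ereal (f y)) / 2 - \<delta>"
    if xy: "f x < \<infinity>" "f y < \<infinity>" and far: "\<epsilon> \<le> norm (x - y)" for x y
  proof -
    define a b where "a = real_of_ereal (f x)" and "b = real_of_ereal (f y)"
    have ab: "f x = ereal a" "f y = ereal b"
      using ereal_eq_real_on_domain[OF proper] xy by (simp_all add: a_def b_def)
    have "(f x + f y) / 2 - ereal \<delta> = ereal ((a + b) / 2 - \<delta>)"
      using ereal_divide[of 2 "a + b"] by (simp add: ab)
    then have le: "f ((1/2) *\<^sub>R (x + y)) \<le> ereal ((a + b) / 2 - \<delta>)" using uc[OF far] by simp
    then have fin: "f ((1/2) *\<^sub>R (x + y)) < \<infinity>" using le_less_trans by fastforce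
    then have "real_of_ereal (f ((1/2) *\<^sub>R (x + y))) \<le> (a + b) / 2 - \<delta>"
      using le ereal_eq_real_on_domain[OF proper fin] by (metis ereal_less_eq(3))
    then show ?thesis using fin by (simp add: a_def b_def)
  qed
  then have "midpoint_drop_on {x. f x < \<infinity>} (\<lambda>x. real_of_ereal (f x)) \<epsilon> \<delta>"
    by (simp add: midpoint_drop_on_def)
  then show ?thesis using that \<delta> by blast
qed

lemma midpoint_drop_on_add_linear:
  fixes q :: "'a::real_normed_vector \<Rightarrow>\<^sub>L real"
  assumes "midpoint_drop_on D \<phi> \<epsilon> \<delta>"
  shows "midpoint_drop_on D (\<lambda>x. \<phi> x + q x) \<epsilon> \<delta>"
proof -
  have "q ((1/2) *\<^sub>R (x + y)) = (q x + q y) / 2" for x y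
    by (simp add: blinfun.add_right blinfun.scaleR_right)
  then show ?thesis using assms by (simp add: midpoint_drop_on_def add_divide_distrib) fastforce
qed

lemma proper_envelope_imp_locally_bounded_below:
  fixes f :: "'a::real_normed_vector \<Rightarrow> ereal"
  assumes proper: "proper_fun f" and env: "proper_fun (lsc_convex_envelope f)" and x: "f x < \<infinity>"
  shows "\<exists>K. \<forall>z. f z < \<infinity> \<longrightarrow> norm (z - x) < R \<longrightarrow> real_of_ereal (f x) - K \<le> real_of_ereal (f z)"
proof -
  let ?C = "closure (convex hull (ereal_epigraph f))"
  have inC: "(z, real_of_ereal (f z)) \<in> ?C" if "f z < \<infinity>" for z
  proof -
    have "f z \<le> ereal (real_of_ereal (f z))"
      using ereal_eq_real_on_domain[OF proper that] by (rule eq_refl)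
    then have "(z, real_of_ereal (f z)) \<in> ereal_epigraph f" by (simp add: ereal_epigraph_def)
    then show ?thesis using closure_subset hull_subset[of "ereal_epigraph f" convex] by blast
  qed
  have "- \<infinity> < lsc_convex_envelope f x" using env by (simp add: proper_fun_def)
  then obtain s where "ereal s < lsc_convex_envelope f x" using ereal_dense2 by blast
  then have "(x, s) \<notin> ereal_epigraph (lsc_convex_envelope f)"
    by (simp add: ereal_epigraph_def)
  then have s: "(x, s) \<notin> ?C" by (simp add: ereal_epigraph_lsc_convex_envelope)
  obtain K where "\<forall>(z, t) \<in> ?C. norm (z - x) < R \<longrightarrow> real_of_ereal (f x) - K \<le> t"
    using closed_convex_epigraph_locally_bounded_below[OF closed_closure _ inC[OF x] s, of R]
      closed_convex_hull_epigraph_upward[of _ _ f] convex_closure[OF convex_convex_hull]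
    by blast
  then show ?thesis using inC by blast
qed

text \<open>
  If the infimum were \<open>- \<infinity>\<close>, so would be the right-hand side, and the strict inequality would fail.
  Hence the existence of a near-minimizer already bounds the perturbed function below.
\<close>
lemma near_minimizer_on_domain:
  assumes proper: "proper_fun f"
    and near: "f x + ereal (q x) < (INF y. f y + ereal (q y)) + ereal d"
  shows "f x < \<infinity>"
    and "f z < \<infinity> \<Longrightarrow> real_of_ereal (f x) + q x - d \<le> real_of_ereal (f z) + q z"
proof -
  show x: "f x < \<infinity>" using near by (cases "f x") auto
  assume z: "f z < \<infinity>"
  have "(INF y. f y + ereal (q y)) + ereal d \<le> f z + ereal (q z) + ereal d"
    by (intro add_right_mono INF_lower) simp
  then have "f x + ereal (q x) < f z + ereal (q z) + ereal d" using near by (rule less_le_trans[rotated])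
  then show "real_of_ereal (f x) + q x - d \<le> real_of_ereal (f z) + q z"
    using ereal_eq_real_on_domain[OF proper x] ereal_eq_real_on_domain[OF proper z]
    by (metis ereal_less(1) less_eq_real_def less_ereal.simps(1) plus_ereal.simps(1)
        diff_le_eq)
qed

text \<open>
  The epigraph of \<open>f + q\<close> is the preimage of that of \<open>f\<close> under a shear, so it is closed and convex
  again. Half of \<open>\<eta>\<close> is used in Ekeland's principle because the subgradient is controlled by a
  non-strict inequality only.
\<close>
lemma linear_perturbation_attains_minimum:
  fixes f :: "'a::banach \<Rightarrow> ereal" and q :: "'a \<Rightarrow>\<^sub>L real"
  assumes proper: "proper_fun f" and "closed (ereal_epigraph f)" "convex (ereal_epigraph f)"
    and bdd: "\<And>z. f z < \<infinity> \<Longrightarrow> m \<le> real_of_ereal (f z) + q z" and "0 < \<eta>"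
  obtains q' :: "'a \<Rightarrow>\<^sub>L real" and x
    where "norm (q' - q) < \<eta>" "is_arg_min (\<lambda>y. f y + ereal (q' y)) (\<lambda>_. True) x"
proof -
  define D where "D = {x. f x < \<infinity>}"
  define \<psi> where "\<psi> x = real_of_ereal (f x) + q x" for x
  have fD: "f x = ereal (\<psi> x - q x)" if "x \<in> D" for x
    using ereal_eq_real_on_domain[OF proper] that by (simp add: D_def \<psi>_def)
  have "f x \<le> ereal (t - q x) \<longleftrightarrow> x \<in> D \<and> \<psi> x \<le> t" for x t
  proof (cases "x \<in> D")
    case False
    then show ?thesis by (simp add: D_def)
  qed (simp add: fD)
  then have epi: "epigraph D \<psi> = (\<lambda>z. (fst z, snd z - q (fst z))) -` ereal_epigraph f"
    by (auto simp: epigraph_def ereal_epigraph_def)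
  have "closed (epigraph D \<psi>)"
    unfolding epi by (intro closed_vimage assms(2) continuous_intros)
  moreover have "D \<noteq> {}" using proper by (simp add: D_def proper_fun_def)
  moreover have "m \<le> \<psi> z" if "z \<in> D" for z using bdd that by (simp add: D_def \<psi>_def)
  moreover have "0 < \<eta> / 2" using \<open>0 < \<eta>\<close> by simp
  ultimately obtain x where x: "x \<in> D" and ek: "\<And>y. y \<in> D \<Longrightarrow> \<psi> x \<le> \<psi> y + \<eta> / 2 * dist y x"
    using ekeland_minimizer[of D \<psi> m "\<eta> / 2"] by blast
  have "linear (\<lambda>z. (fst z, snd z - q (fst z)))"
    by (rule linearI) (simp_all add: blinfun.add_right blinfun.scaleR_right algebra_simps)
  then have "convex (epigraph D \<psi>)"
    unfolding epi using assms(3) by (rule convex_linear_vimage)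
  then have conv: "convex_on D \<psi>" by (simp add: convex_epigraph)
  have "0 \<le> \<eta> / 2" and cone: "\<And>y. y \<in> D \<Longrightarrow> \<psi> x \<le> \<psi> y + \<eta> / 2 * norm (y - x)"
    using ek \<open>0 < \<eta>\<close> by (simp_all add: dist_norm)
  then obtain p :: "'a \<Rightarrow>\<^sub>L real" where p: "norm p \<le> \<eta> / 2"
    and sub: "\<And>y. y \<in> D \<Longrightarrow> \<psi> x \<le> \<psi> y + p (y - x)"
    using subgradient_from_cone_minorant[OF conv x] by blast
  have "f x + ereal ((q + p) x) \<le> f y + ereal ((q + p) y)" for y
  proof (cases "y \<in> D")
    case True
    then show ?thesis
      using sub[OF True] fD[OF x] fD[OF True]
      by (simp add: blinfun.add_left blinfun.diff_right)
  next
    case False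
    then show ?thesis by (simp add: D_def)
  qed
  then have "is_arg_min (\<lambda>y. f y + ereal ((q + p) y)) (\<lambda>_. True) x"
    by (simp add: is_arg_min_def not_less)
  moreover have "norm (q + p - q) < \<eta>" using p \<open>0 < \<eta>\<close> by simp
  ultimately show ?thesis using that by blast
qed

theorem theorem1p2:
  fixes f :: "'a::banach \<Rightarrow> ereal" and \<epsilon> :: real
  assumes "\<epsilon> > 0"
    and "proper_fun f"
    and "eps_uniformly_convex \<epsilon> f"
    and "proper_fun (lsc_convex_envelope f)"
  shows "(\<exists>m::real. \<forall>x. ereal m \<le> f x)
    \<and> (f \<longlongrightarrow> \<infinity>) at_infinity
    \<and> Liminf at_infinity (\<lambda>x. f x / ereal ((norm x)\<^sup>2)) > 0
    \<and> (\<forall>\<epsilon>' > \<epsilon>. \<exists>\<delta> \<eta> :: real. \<delta> > 0 \<and> \<eta> > 0 \<and>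
        (\<forall>(x0' :: 'a \<Rightarrow>\<^sub>L real) x0.
           f x0 + ereal (blinfun_apply x0' x0)
             < (INF y. f y + ereal (blinfun_apply x0' y)) + ereal \<delta> \<longrightarrow>
           (\<forall>(x' :: 'a \<Rightarrow>\<^sub>L real) x.
              norm (x' - x0') < \<eta> \<longrightarrow>
              is_arg_min (\<lambda>y. f y + ereal (blinfun_apply x' y)) (\<lambda>_. True) x \<longrightarrow>
              norm (x - x0) \<le> \<epsilon>')
           \<and> (f = lsc_convex_envelope f \<longrightarrow>
              (\<exists>(x' :: 'a \<Rightarrow>\<^sub>L real) x.
                 norm (x' - x0') < \<eta> \<and>
                 is_arg_min (\<lambda>y. f y + ereal (blinfun_apply x' y)) (\<lambda>_. True) x))))"
proof -
  define D where "D = {x. f x < \<infinity>}"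
  define \<phi> where "\<phi> x = real_of_ereal (f x)" for x
  note proper = assms(2)
  have fD: "f x = ereal (\<phi> x)" if "x \<in> D" for x
    using ereal_eq_real_on_domain[OF proper] that by (simp add: D_def \<phi>_def)
  have f_notD: "f x = \<infinity>" if "x \<notin> D" for x using that by (simp add: D_def)
  obtain \<delta> where \<delta>: "0 < \<delta>" and drop: "midpoint_drop_on D \<phi> \<epsilon> \<delta>"
    using eps_uniformly_convex_midpoint_drop[OF proper assms(3)]
    unfolding D_def \<phi>_def by blast
  obtain x1 where x1: "x1 \<in> D" using proper by (auto simp: D_def proper_fun_def)
  obtain K where loc: "\<And>z. z \<in> D \<Longrightarrow> norm (z - x1) < \<epsilon> \<Longrightarrow> \<phi> x1 - K \<le> \<phi> z"
    using proper_envelope_imp_locally_bounded_below[OF proper assms(4), of x1 \<epsilon>] x1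
    unfolding D_def \<phi>_def by blast
  note growth = quadratic_growth_and_lower_bound[OF drop x1 assms(1) \<delta> loc]
  have bounded: "\<exists>m::real. \<forall>x. ereal m \<le> f x"
  proof -
    obtain m where m: "\<forall>y\<in>D. m \<le> \<phi> y" using growth(1) by blast
    have "ereal m \<le> f x" for x using m fD[of x] f_notD[of x] by (cases "x \<in> D") auto
    then show ?thesis by blast
  qed
  obtain c R where c: "0 < c" and quadD: "\<forall>y\<in>D. R \<le> norm y \<longrightarrow> c * (norm y)\<^sup>2 \<le> \<phi> y"
    using growth(2) by blast
  have quad: "ereal (c * (norm x)\<^sup>2) \<le> f x" if "R \<le> norm x" for x
    using quadD that fD[of x] f_notD[of x] by (cases "x \<in> D") auto
  have coercive: "(f \<longlongrightarrow> \<infinity>) at_infinity"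
    unfolding tendsto_PInfty eventually_at_infinity
  proof
    fix r :: real
    have "ereal r < f x" if x: "max R (1 + \<bar>r\<bar> / c) \<le> norm x" for x
    proof -
      have "0 \<le> \<bar>r\<bar> / c" using c by simp
      then have "1 \<le> norm x" using x by linarith
      have "\<bar>r\<bar> + c \<le> c * norm x"
        using x c by (simp add: field_simps)
      also have "\<dots> \<le> c * (norm x)\<^sup>2"
        using \<open>1 \<le> norm x\<close> c by (intro mult_left_mono self_le_power) auto
      finally have "r < c * (norm x)\<^sup>2" using c by linarith
      then have "ereal r < ereal (c * (norm x)\<^sup>2)" by simp
      also have "\<dots> \<le> f x" using x by (intro quad) simp
      finally show ?thesis .
    qed
    then show "\<exists>b. \<forall>x. b \<le> norm x \<longrightarrow> ereal r < f x" by blast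
  qed
  have liminf: "Liminf at_infinity (\<lambda>x. f x / ereal ((norm x)\<^sup>2)) > 0"
  proof -
    have "ereal c \<le> f x / ereal ((norm x)\<^sup>2)" if x: "max R 1 \<le> norm x" for x
    proof -
      have "0 < (norm x)\<^sup>2" using x by (intro zero_less_power) linarith
      moreover have "ereal c * ereal ((norm x)\<^sup>2) \<le> f x" using quad[of x] x by simp
      ultimately show ?thesis by (simp add: ereal_le_divide_pos mult.commute)
    qed
    then have "ereal c \<le> Liminf at_infinity (\<lambda>x. f x / ereal ((norm x)\<^sup>2))"
      by (intro Liminf_bounded) (unfold eventually_at_infinity, blast)
    then show ?thesis using c by (metis ereal_less(2) less_le_trans)
  qed
  \<comment> \<open>The perturbation has Lipschitz constant below \<open>\<delta> / (2 * \<epsilon>)\<close>, the rate at which the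
    function perturbed by \<open>x0'\<close> rises away from its \<open>\<delta> / 2\<close>-minimizer \<open>x0\<close>.\<close>
  have localize: "norm (x - x0) \<le> \<epsilon>'"
    if "\<epsilon> < \<epsilon>'" and near: "f x0 + ereal (blinfun_apply x0' x0)
          < (INF y. f y + ereal (blinfun_apply x0' y)) + ereal (\<delta> / 2)"
      and close: "norm (x' - x0') < \<delta> / (2 * \<epsilon>)"
      and min: "is_arg_min (\<lambda>y. f y + ereal (blinfun_apply x' y)) (\<lambda>_. True) x"
    for \<epsilon>' x0 x and x0' x' :: "'a \<Rightarrow>\<^sub>L real"
  proof (rule ccontr)
    assume "\<not> norm (x - x0) \<le> \<epsilon>'"
    then have far: "\<epsilon> \<le> norm (x - x0)" using \<open>\<epsilon> < \<epsilon>'\<close> by simp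
    have x0: "x0 \<in> D" using near_minimizer_on_domain(1)[OF proper near] by (simp add: D_def)
    have le: "f x + ereal (x' x) \<le> f x0 + ereal (x' x0)"
      using min by (simp add: is_arg_min_def not_less)
    then have x: "x \<in> D" using f_notD[of x] fD[OF x0] by (cases "x \<in> D") auto
    have "\<phi> x0 + x0' x0 + \<delta> / (2 * \<epsilon>) * norm (x - x0) < \<phi> x + x0' x"
    proof (rule near_minimizer_linear_growth[OF midpoint_drop_on_add_linear[OF drop] x0 x
          assms(1) \<delta> far])
      fix z assume "z \<in> D"
      then show "\<phi> x0 + x0' x0 - \<delta> / 2 \<le> \<phi> z + x0' z"
        using near_minimizer_on_domain(2)[OF proper near] by (simp add: D_def \<phi>_def)
    qed
    moreover have "\<phi> x + x' x \<le> \<phi> x0 + x' x0" using le fD[OF x] fD[OF x0] by simp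
    moreover have "- ((x' - x0') (x - x0)) \<le> \<delta> / (2 * \<epsilon>) * norm (x - x0)"
    proof -
      have "- ((x' - x0') (x - x0)) \<le> norm ((x' - x0') (x - x0))" by simp
      also have "\<dots> \<le> norm (x' - x0') * norm (x - x0)" by (rule norm_blinfun)
      also have "\<dots> \<le> \<delta> / (2 * \<epsilon>) * norm (x - x0)"
        using close by (intro mult_right_mono) auto
      finally show ?thesis .
    qed
    ultimately show False by (simp add: blinfun.diff_left blinfun.diff_right)
  qed
  have attained: "\<exists>(x' :: 'a \<Rightarrow>\<^sub>L real) x. norm (x' - x0') < \<delta> / (2 * \<epsilon>) \<and>
      is_arg_min (\<lambda>y. f y + ereal (blinfun_apply x' y)) (\<lambda>_. True) x"
    if near: "f x0 + ereal (blinfun_apply x0' x0)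
          < (INF y. f y + ereal (blinfun_apply x0' y)) + ereal (\<delta> / 2)"
      and env: "f = lsc_convex_envelope f"
    for x0 and x0' :: "'a \<Rightarrow>\<^sub>L real"
  proof -
    have epi: "ereal_epigraph f = closure (convex hull (ereal_epigraph f))"
      using ereal_epigraph_lsc_convex_envelope[of f] env by simp
    have "closed (ereal_epigraph f)" by (subst epi) (rule closed_closure)
    moreover have "convex (ereal_epigraph f)"
      by (subst epi) (rule convex_closure[OF convex_convex_hull])
    moreover have "0 < \<delta> / (2 * \<epsilon>)" using \<delta> assms(1) by simp
    ultimately show ?thesis
      using linear_perturbation_attains_minimum[OF proper _ _
          near_minimizer_on_domain(2)[OF proper near]] by metis
  qed
  have "0 < \<delta> / 2" "0 < \<delta> / (2 * \<epsilon>)" using \<delta> assms(1) by simp_all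
  then show ?thesis
    using bounded coercive liminf localize attained by blast
qed

end
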